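(* Let $n\ge2$ be an integer. If there is no sharply transitive subset of $C_{n-1}\wr S_n$ on the set of pairs $((c_1,i_1),(c_2,i_2))\in(C_{n-1}\times[n])^2$ with $i_1\neq i_2$ (i.e. no $2$-design of index $1$ in $C_{n-1}\wr S_n$), then there is no projective plane of order $n-1$ or there is no projective plane of order $n$.
   Context: $C_m=\mathbb{Z}/m\mathbb{Z}$, $[n]=\{1,\dots,n\}$. $C_m\wr S_n$ consists of pairs $(g,\pi)$, $g\in C_m^n$, $\pi\in S_n$, with $(f,\pi)(g,\sigma)=(f+g^\pi,\pi\sigma)$, $g^\pi=(g_{\pi^{-1}(1)},\dots,g_{\pi^{-1}(n)})$, acting on $C_m\times[n]$ by $(g,\pi)\cdot(c,i)=(c+g_{\pi(i)},\pi(i))$ and componentwise on pairs. A subset $Y$ is sharply transitive on a set $\Omega$ if for all $a,b\in\Omega$ exactly one $y\in Y$ satisfies $ya=b$. A projective plane of order $m$ is a finite projective plane with $m+1$ points on each line. *)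

theory Defs
  imports "HOL-Algebra.Elementary_Groups" "HOL-Algebra.Product_Groups" "HOL-Algebra.Sym_Groups"
begin

section \<open>The wreath product of a cyclic group with the symmetric group\<close>

text \<open>Here C_m is \<^term>\<open>integer_mod_group m\<close> (carrier \<^term>\<open>{0..<int m}\<close> if m > 0), the set [n] is
  \<^term>\<open>{1..n}\<close>, and the n-th power of C_m consists of extensional functions on [n].\<close>

definition perm_coords :: "nat \<Rightarrow> (nat \<Rightarrow> nat) \<Rightarrow> (nat \<Rightarrow> 'a) \<Rightarrow> nat \<Rightarrow> 'a"
  where "perm_coords n \<pi> g = (\<lambda>i\<in>{1..n}. g (inv' \<pi> i))"

definition cyclic_wreath :: "nat \<Rightarrow> nat \<Rightarrow> ((nat \<Rightarrow> int) \<times> (nat \<Rightarrow> nat)) monoid"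
  where "cyclic_wreath m n =
    (let B = product_group {1..n} (\<lambda>_. integer_mod_group m) in
     \<lparr>carrier = carrier B \<times> carrier (sym_group n),
      monoid.mult = (\<lambda>(f, \<pi>) (g, \<sigma>). (f \<otimes>\<^bsub>B\<^esub> perm_coords n \<pi> g, \<pi> \<otimes>\<^bsub>sym_group n\<^esub> \<sigma>)),
      one = (\<one>\<^bsub>B\<^esub>, \<one>\<^bsub>sym_group n\<^esub>)\<rparr>)"

definition wreath_act ::
    "nat \<Rightarrow> (nat \<Rightarrow> int) \<times> (nat \<Rightarrow> nat) \<Rightarrow> int \<times> nat \<Rightarrow> int \<times> nat"
  where "wreath_act m = (\<lambda>(g, \<pi>) (c, i). (c \<otimes>\<^bsub>integer_mod_group m\<^esub> g (\<pi> i), \<pi> i))"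

definition wreath_act_pair ::
    "nat \<Rightarrow> (nat \<Rightarrow> int) \<times> (nat \<Rightarrow> nat) \<Rightarrow> (int \<times> nat) \<times> (int \<times> nat) \<Rightarrow> (int \<times> nat) \<times> (int \<times> nat)"
  where "wreath_act_pair m y = map_prod (wreath_act m y) (wreath_act m y)"

definition coloured_points :: "nat \<Rightarrow> nat \<Rightarrow> (int \<times> nat) set"
  where "coloured_points m n = carrier (integer_mod_group m) \<times> {1..n}"

definition coloured_pairs :: "nat \<Rightarrow> nat \<Rightarrow> ((int \<times> nat) \<times> (int \<times> nat)) set"
  where "coloured_pairs m n =
    {((c1, i1), (c2, i2)) | c1 i1 c2 i2.
       (c1, i1) \<in> coloured_points m n \<and> (c2, i2) \<in> coloured_points m n \<and> i1 \<noteq> i2}"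

definition sharply_transitive_on :: "('g \<Rightarrow> 'x \<Rightarrow> 'x) \<Rightarrow> 'g set \<Rightarrow> 'x set \<Rightarrow> bool"
  where "sharply_transitive_on act Y \<Omega> \<longleftrightarrow> (\<forall>a\<in>\<Omega>. \<forall>b\<in>\<Omega>. \<exists>!y. y \<in> Y \<and> act y a = b)"

lemma cyclic_wreath_carrier:
  "(g, \<pi>) \<in> carrier (cyclic_wreath m n) \<longleftrightarrow>
     g \<in> {1..n} \<rightarrow>\<^sub>E carrier (integer_mod_group m) \<and> \<pi> permutes {1..n}"
  by (simp add: cyclic_wreath_def Let_def sym_group_carrier)

lemma wreath_act_mult:
  assumes "x \<in> carrier (cyclic_wreath m n)" "y \<in> carrier (cyclic_wreath m n)"
    and "p \<in> coloured_points m n"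
  shows "wreath_act m (x \<otimes>\<^bsub>cyclic_wreath m n\<^esub> y) p = wreath_act m x (wreath_act m y p)"
proof -
  obtain f \<pi> g \<sigma> c i where [simp]: "x = (f, \<pi>)" "y = (g, \<sigma>)" "p = (c, i)"
    by (metis surj_pair)
  have perm: "\<pi> permutes {1..n}" "\<sigma> permutes {1..n}"
    using assms by (simp_all add: cyclic_wreath_carrier)
  have "i \<in> {1..n}"
    using assms by (simp add: coloured_points_def)
  then have "\<pi> (\<sigma> i) \<in> {1..n}"
    using perm by (metis permutes_in_image)
  then show ?thesis
    using permutes_inverses(2)[OF perm(1)]
    by (simp add: wreath_act_def cyclic_wreath_def Let_def perm_coords_def product_group_def
        sym_group_mult mod_simps algebra_simps)
qed


section \<open>Finite projective planes\<close>

text \<open>Lines are identified with their sets of points. Nondegeneracy is the usual one (there are four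
  points, no three of them on a common line), so every projective plane has order at least 2.\<close>

locale finite_projective_plane =
  fixes P :: "'p set" and L :: "'p set set"
  assumes finite_points: "finite P"
    and lines_subset: "l \<in> L \<Longrightarrow> l \<subseteq> P"
    and unique_line: "\<lbrakk>x \<in> P; y \<in> P; x \<noteq> y\<rbrakk> \<Longrightarrow> \<exists>!l. l \<in> L \<and> x \<in> l \<and> y \<in> l"
    and unique_point: "\<lbrakk>k \<in> L; l \<in> L; k \<noteq> l\<rbrakk> \<Longrightarrow> \<exists>!x. x \<in> k \<and> x \<in> l"
    and quadrangle: "\<exists>Q\<subseteq>P. card Q = 4 \<and> (\<forall>l\<in>L. card (Q \<inter> l) \<le> 2)"

definition projective_plane_of_order :: "nat \<Rightarrow> 'p set \<Rightarrow> 'p set set \<Rightarrow> bool"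
  where "projective_plane_of_order m P L \<longleftrightarrow>
    finite_projective_plane P L \<and> (\<forall>l\<in>L. card l = m + 1)"

end

theory Submission
  imports Defs
begin

text \<open>
  A plane of order \<open>m\<close> and a distinguished line in it give an orthogonal array: each of the remaining
  \<open>m\<^sup>2\<close> points \<open>p\<close> is a row, whose entry in the column of a point \<open>x\<close> of the line is the label of the
  line \<open>xp\<close>. A plane of order \<open>n\<close> and two points \<open>x\<close>, \<open>y\<close> in it give a sharply 2-transitive set of
  permutations of \<open>[n]\<close>: a line through neither point defines a projectivity from the pencil at \<open>x\<close> to
  the pencil at \<open>y\<close>, both taken without the line \<open>xy\<close>. For \<open>m = n - 1\<close>, the product of the two sets is
  sharply transitive: the second component is determined by the indices, and then the first one by
  the colours.
\<close>

section \<open>Projective planes\<close>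

context finite_projective_plane
begin

definition join :: "'p \<Rightarrow> 'p \<Rightarrow> 'p set"
  where "join x y = (THE l. l \<in> L \<and> x \<in> l \<and> y \<in> l)"

definition meet :: "'p set \<Rightarrow> 'p set \<Rightarrow> 'p"
  where "meet k l = (THE x. x \<in> k \<and> x \<in> l)"

definition pencil :: "'p \<Rightarrow> 'p set set"
  where "pencil x = {l \<in> L. x \<in> l}"

lemma point_of_line: "l \<in> L \<Longrightarrow> x \<in> l \<Longrightarrow> x \<in> P"
  using lines_subset by blast

lemma join:
  assumes "x \<in> P" "y \<in> P" "x \<noteq> y"
  shows "join x y \<in> L" "x \<in> join x y" "y \<in> join x y"
  using theI'[OF unique_line[OF assms]] by (simp_all add: join_def)

lemma join_eq: "l \<in> L \<Longrightarrow> x \<in> l \<Longrightarrow> y \<in> l \<Longrightarrow> x \<noteq> y \<Longrightarrow> join x y = l"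
  unfolding join_def by (rule the1_equality) (use unique_line point_of_line in auto)

lemma meet:
  assumes "k \<in> L" "l \<in> L" "k \<noteq> l"
  shows "meet k l \<in> k" "meet k l \<in> l"
  using theI'[OF unique_point[OF assms]] by (simp_all add: meet_def)

lemma meet_eq: "k \<in> L \<Longrightarrow> l \<in> L \<Longrightarrow> k \<noteq> l \<Longrightarrow> x \<in> k \<Longrightarrow> x \<in> l \<Longrightarrow> meet k l = x"
  unfolding meet_def by (rule the1_equality) (use unique_point in auto)

lemma lines_eqI: "\<lbrakk>k \<in> L; l \<in> L; x \<in> k; y \<in> k; x \<in> l; y \<in> l; x \<noteq> y\<rbrakk> \<Longrightarrow> k = l"
  using join_eq by metis

text \<open>If every line passed through \<open>x\<close>, take three points \<open>a\<close>,
  \<open>b\<close>, \<open>c\<close> of the quadrangle other than \<open>x\<close>. The lines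
  \<open>ab\<close> and \<open>ac\<close> share \<open>a\<close> and \<open>x\<close>, so they
  coincide and contain three points of the quadrangle.\<close>

lemma ex_line_avoiding: "\<exists>l\<in>L. x \<notin> l"
proof (rule ccontr)
  assume "\<not> ?thesis"
  then have all: "x \<in> l" if "l \<in> L" for l
    using that by blast
  obtain Q where Q: "Q \<subseteq> P" "card Q = 4" "\<And>l. l \<in> L \<Longrightarrow> card (Q \<inter> l) \<le> 2"
    using quadrangle by auto
  have "card (Q - {x}) \<ge> 3"
    using Q(2) by (simp add: card_Diff_singleton_if)
  then obtain T where T: "T \<subseteq> Q - {x}" "card T = 3"
    by (meson obtain_subset_with_card_n)
  then obtain a b c where abc: "T = {a, b, c}" "a \<noteq> b" "a \<noteq> c" "b \<noteq> c"
    by (auto simp: card_3_iff)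
  have P: "a \<in> P" "b \<in> P" "c \<in> P" "a \<noteq> x"
    using T Q(1) abc(1) by auto
  have "join a b = join a c"
    using join P abc all by (intro lines_eqI[of _ _ a x]) simp_all
  then have "T \<subseteq> Q \<inter> join a b"
    using T join P abc by auto
  moreover have "finite Q"
    using Q(2) card.infinite by fastforce
  ultimately have "3 \<le> card (Q \<inter> join a b)"
    using T(2) card_mono by (metis finite_Int)
  then show False
    using Q(3)[of "join a b"] join(1) P abc by fastforce
qed

text \<open>This is the perspectivity with centre \<open>x\<close>; intersecting with
  \<open>l\<close> inverts it. It transfers the size of a line to the size of a pencil.\<close>

lemma bij_betw_join_pencil:
  assumes "x \<in> P" "l \<in> L" "x \<notin> l"
  shows "bij_betw (join x) l (pencil x)"
proof (rule bij_betw_byWitness[where f' = "\<lambda>k. meet k l"])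
  show "\<forall>y\<in>l. meet (join x y) l = y"
    using assms join point_of_line by (metis meet_eq)
  show "\<forall>k\<in>pencil x. join x (meet k l) = k"
    using assms meet by (metis (lifting) join_eq mem_Collect_eq pencil_def)
  show "join x ` l \<subseteq> pencil x"
    using assms join point_of_line by (fastforce simp: pencil_def)
  show "(\<lambda>k. meet k l) ` pencil x \<subseteq> l"
    using assms meet by (fastforce simp: pencil_def)
qed

end

lemma projective_plane_of_orderD:
  assumes "projective_plane_of_order q P L"
  shows "finite_projective_plane P L" "l \<in> L \<Longrightarrow> card l = q + 1"
  using assms by (simp_all add: projective_plane_of_order_def)

text \<open>The full pencil at \<open>x\<close> is in bijection with the \<open>q + 1\<close> points
  of a line avoiding \<open>x\<close>, and \<open>l\<close> is one of its members.\<close>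

lemma card_punctured_pencil:
  assumes "projective_plane_of_order q P L" "l \<in> L" "x \<in> l"
  shows "finite (finite_projective_plane.pencil L x - {l})"
    and "card (finite_projective_plane.pencil L x - {l}) = q"
proof -
  interpret finite_projective_plane P L
    using assms(1) by (rule projective_plane_of_orderD)
  obtain k where k: "k \<in> L" "x \<notin> k"
    using ex_line_avoiding by blast
  have bij: "bij_betw (join x) k (pencil x)"
    using assms k point_of_line by (blast intro: bij_betw_join_pencil)
  have "finite k"
    using k finite_points lines_subset finite_subset by blast
  then show "finite (pencil x - {l})"
    using bij_betw_finite[OF bij] by simp
  show "card (pencil x - {l}) = q"
    using assms bij_betw_same_card[OF bij] projective_plane_of_orderD(2)[OF assms(1) k(1)]
    by (simp add: card_Diff_singleton_if pencil_def)
qed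

section \<open>Orthogonal arrays\<close>

text \<open>Strength two and index one. Rows are extensional functions, so for
  \<open>I = {1..n}\<close> and \<open>S\<close> the carrier of the cyclic group they are elements
  of the base group of the wreath product.\<close>

definition orthogonal_array :: "'i set \<Rightarrow> 's set \<Rightarrow> ('i \<Rightarrow> 's) set \<Rightarrow> bool"
  where "orthogonal_array I S A \<longleftrightarrow> A \<subseteq> I \<rightarrow>\<^sub>E S \<and>
    (\<forall>i\<in>I. \<forall>j\<in>I. \<forall>a\<in>S. \<forall>b\<in>S. i \<noteq> j \<longrightarrow> (\<exists>!g. g \<in> A \<and> g i = a \<and> g j = b))"

text \<open>Prescribing one entry of a row prescribes a line other than \<open>l\<close> on which
  its point lies. Entries in two columns give lines through different points of \<open>l\<close>;
  these lines are distinct and meet in exactly one point.\<close>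

lemma orthogonal_array_of_plane:
  assumes "projective_plane_of_order q P L"
    and "finite I" "card I = q + 1" "finite S" "card S = q"
  shows "\<exists>A. orthogonal_array I S A"
proof -
  interpret finite_projective_plane P L
    using assms(1) by (rule projective_plane_of_orderD)
  obtain l where l: "l \<in> L"
    using ex_line_avoiding by blast
  have "finite l"
    using l finite_points lines_subset finite_subset by blast
  then obtain e where e: "bij_betw e I l"
    using assms(2,3) l projective_plane_of_orderD(2)[OF assms(1)]
    by (metis finite_same_card_bij)
  have e_l: "e i \<in> l" if "i \<in> I" for i
    using e that by (auto simp: bij_betw_def)
  have e_inj: "e i \<noteq> e j" if "i \<in> I" "j \<in> I" "i \<noteq> j" for i j
    using e that by (auto simp: bij_betw_def inj_on_def)
  \<comment> \<open>Each point of \<open>l\<close> lies on exactly \<open>q\<close> further lines,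
    so \<open>S\<close> labels them; the labellings at different points are chosen
    independently.\<close>
  have "\<exists>f. bij_betw f (pencil x - {l}) S" if "x \<in> l" for x
    using card_punctured_pencil[OF assms(1) l that] assms(4,5) by (intro finite_same_card_bij) auto
  then obtain lab where lab: "\<And>x. x \<in> l \<Longrightarrow> bij_betw (lab x) (pencil x - {l}) S"
    by metis
  define row where "row p = (\<lambda>i\<in>I. lab (e i) (join (e i) p))" for p
  have mem: "join x p \<in> pencil x - {l}" if "x \<in> l" "p \<in> P - l" for x p
    using that l join[of x p] point_of_line by (auto simp: pencil_def)
  \<comment> \<open>Labels are injective on each punctured pencil, so entries of rows translate into
    incidences; the rest of the argument uses only these.\<close>
  have row_eq: "row p i = lab (e i) k \<longleftrightarrow> p \<in> k"
    if "p \<in> P - l" "i \<in> I" "k \<in> pencil (e i) - {l}" for p i k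
  proof -
    have "row p i = lab (e i) k \<longleftrightarrow> join (e i) p = k"
      using that mem[of "e i" p] e_l lab[of "e i"] by (auto simp: row_def bij_betw_def inj_on_def)
    also have "\<dots> \<longleftrightarrow> p \<in> k"
      using that e_l[of i] l join[of "e i" p] join_eq[of k "e i" p] point_of_line[OF l]
      by (auto simp: pencil_def)
    finally show ?thesis .
  qed
  have "\<exists>!g. g \<in> row ` (P - l) \<and> g i = a \<and> g j = b"
    if ij: "i \<in> I" "j \<in> I" "i \<noteq> j" and ab: "a \<in> S" "b \<in> S" for i j a b
  proof -
    obtain h where h: "h \<in> pencil (e i) - {l}" "a = lab (e i) h"
      using lab[OF e_l[OF ij(1)]] ab by (auto simp: bij_betw_def)
    obtain k where k: "k \<in> pencil (e j) - {l}" "b = lab (e j) k"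
      using lab[OF e_l[OF ij(2)]] ab by (auto simp: bij_betw_def)
    have hk: "h \<in> L" "k \<in> L" "h \<noteq> l" "k \<noteq> l" "e i \<in> h" "e j \<in> k"
      using h k by (auto simp: pencil_def)
    have ne: "h \<noteq> k"
      using hk lines_eqI[of h l "e i" "e j"] l e_l ij e_inj by metis
    define p where "p = meet h k"
    have p: "p \<in> h" "p \<in> k"
      using meet hk ne by (auto simp: p_def)
    \<comment> \<open>On \<open>l\<close>, the point \<open>p\<close> would have to be
      \<open>e i\<close>, where \<open>h\<close> meets \<open>l\<close>, and also
      \<open>e j\<close>, where \<open>k\<close> meets \<open>l\<close>.\<close>
    have "p \<notin> l"
      using p hk e_l ij e_inj l lines_eqI by metis
    then have p': "p \<in> P - l"
      using p hk point_of_line by blast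
    show ?thesis
    proof (rule ex1I[of _ "row p"])
      show "row p \<in> row ` (P - l) \<and> row p i = a \<and> row p j = b"
        using p p' h k ij row_eq by auto
      show "g = row p" if g: "g \<in> row ` (P - l) \<and> g i = a \<and> g j = b" for g
      proof -
        obtain r where r: "r \<in> P - l" "g = row r"
          using g by blast
        then have "r \<in> h" "r \<in> k"
          using g row_eq h k ij by auto
        then show ?thesis
          using r hk ne meet_eq p_def by blast
      qed
    qed
  qed
  moreover have "row ` (P - l) \<subseteq> I \<rightarrow>\<^sub>E S"
    using mem lab e_l by (fastforce simp: row_def bij_betw_def)
  ultimately show ?thesis
    unfolding orthogonal_array_def by (intro exI[of _ "row ` (P - l)"]) simp
qed

section \<open>Sharply 2-transitive sets of permutations\<close>

text \<open>A line \<open>k\<close> avoiding \<open>x\<close> and \<open>y\<close> sends a line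
  through \<open>x\<close> to the line through \<open>y\<close> that meets it on \<open>k\<close>.
  Two prescribed values fix two points of \<open>k\<close>, and hence \<open>k\<close>
  itself.\<close>

lemma sharply_2_transitive_of_plane:
  assumes "projective_plane_of_order q P L"
    and "finite I" "card I = q" "q > 0"
  shows "\<exists>D. (\<forall>\<pi>\<in>D. \<pi> permutes I) \<and>
    sharply_transitive_on (\<lambda>\<pi>. map_prod \<pi> \<pi>) D {(i, j). i \<in> I \<and> j \<in> I \<and> i \<noteq> j}"
proof -
  interpret finite_projective_plane P L
    using assms(1) by (rule projective_plane_of_orderD)
  obtain l where l: "l \<in> L"
    using ex_line_avoiding by blast
  have "card l \<ge> 2"
    using l projective_plane_of_orderD(2)[OF assms(1)] assms(4) by simp
  then obtain x y where xy: "x \<in> l" "y \<in> l" "x \<noteq> y"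
    by (meson card_2_iff' obtain_subset_with_card_n subsetD)
  have "\<exists>f. bij_betw f I (pencil z - {l})" if "z \<in> l" for z
    using card_punctured_pencil[OF assms(1) l that] assms(2,3) by (intro finite_same_card_bij) auto
  then obtain r s where r: "bij_betw r I (pencil x - {l})" and s: "bij_betw s I (pencil y - {l})"
    using xy by metis
  have rD: "r i \<in> L" "x \<in> r i" "r i \<noteq> l" "y \<notin> r i" if "i \<in> I" for i
  proof -
    show "r i \<in> L" "x \<in> r i" "r i \<noteq> l"
      using that bij_betwE[OF r] by (auto simp: pencil_def)
    then show "y \<notin> r i"
      using xy l lines_eqI by blast
  qed
  have sD: "s i \<in> L" "y \<in> s i" "s i \<noteq> l" "x \<notin> s i" if "i \<in> I" for i
  proof -
    show "s i \<in> L" "y \<in> s i" "s i \<noteq> l"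
      using that bij_betwE[OF s] by (auto simp: pencil_def)
    then show "x \<notin> s i"
      using xy l lines_eqI by blast
  qed
  have r_inj: "r i = r j \<longleftrightarrow> i = j" and s_inj: "s i = s j \<longleftrightarrow> i = j" if "i \<in> I" "j \<in> I" for i j
    using that r s by (auto simp: bij_betw_def inj_on_def)
  define K where "K = {k \<in> L. x \<notin> k \<and> y \<notin> k}"
  \<comment> \<open>The projectivity is transported to indices along \<open>r\<close> and
    \<open>s\<close>, and extended by the identity outside \<open>I\<close>, as
    \<open>permutes\<close> demands.\<close>
  define proj where
    "proj k i = (if i \<in> I then inv_into I s (join y (meet (r i) k)) else i)" for k i
  have meet_K: "meet (r i) k \<in> r i" "meet (r i) k \<in> k" if "k \<in> K" "i \<in> I" for k i
    using meet[of "r i" k] rD that by (auto simp: K_def)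
  have meet_K_eqI: "meet (r i) k = p" if "k \<in> K" "i \<in> I" "p \<in> r i" "p \<in> k" for k i p
    using meet_eq[of "r i" k p] rD[of i] that by (auto simp: K_def)
  \<comment> \<open>The graph of \<open>proj k\<close> expressed as concurrency: \<open>i\<close>
    goes to \<open>j\<close> exactly when \<open>r i\<close>, \<open>s j\<close> and
    \<open>k\<close> have a common point.\<close>
  have proj_eq_iff: "proj k i \<in> I \<and> (proj k i = j \<longleftrightarrow> meet (r i) k \<in> s j)"
    if k: "k \<in> K" and ij: "i \<in> I" "j \<in> I" for k i j
  proof -
    let ?p = "meet (r i) k"
    have p: "?p \<in> P" "?p \<noteq> y" "?p \<noteq> x"
      using meet_K[OF k ij(1)] k point_of_line by (auto simp: K_def)
    have "?p \<notin> l"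
      using meet_K[OF k ij(1)] p rD[OF ij(1)] l xy lines_eqI by blast
    then have mem: "join y ?p \<in> pencil y - {l}"
      using join[of y ?p] p xy l point_of_line by (auto simp: pencil_def)
    then have *: "proj k i \<in> I" "s (proj k i) = join y ?p"
      using s ij by (auto simp: proj_def bij_betw_def f_inv_into_f inv_into_into)
    have "proj k i = j \<longleftrightarrow> join y ?p = s j"
      using * s_inj ij by metis
    also have "\<dots> \<longleftrightarrow> ?p \<in> s j"
      using join[of y ?p] p xy l point_of_line sD[OF ij(2)] join_eq by metis
    finally show ?thesis
      using * by simp
  qed
  have "proj k permutes I" if k: "k \<in> K" for k
  proof (rule bij_imp_permutes)
    \<comment> \<open>If \<open>i\<close> and \<open>j\<close> have the same image \<open>t\<close>,
      then \<open>r i\<close> and \<open>r j\<close> both pass through the single point where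
      \<open>k\<close> meets \<open>s t\<close>. That point differs from \<open>x\<close>, which
      both also contain, so they agree. Finiteness of \<open>I\<close> then gives
      surjectivity.\<close>
    have "inj_on (proj k) I"
    proof (rule inj_onI)
      fix i j
      assume ij: "i \<in> I" "j \<in> I" "proj k i = proj k j"
      define t where "t = proj k i"
      have t: "t \<in> I"
        using proj_eq_iff k ij t_def by blast
      have "meet (r i) k \<in> s t" "meet (r j) k \<in> s t"
        using proj_eq_iff[OF k ij(1) t] proj_eq_iff[OF k ij(2) t] ij(3) t_def by argo+
      moreover have "s t \<noteq> k"
        using k sD[OF t] by (auto simp: K_def)
      ultimately have "meet (r i) k = meet (r j) k"
        using meet_K k ij sD(1)[OF t] lines_eqI by (metis (mono_tags, lifting) K_def mem_Collect_eq)
      moreover have "meet (r i) k \<noteq> x"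
        using meet_K k ij by (auto simp: K_def)
      ultimately have "r i = r j"
        using meet_K k ij rD lines_eqI by metis
      then show "i = j"
        using r_inj ij by simp
    qed
    moreover have "proj k ` I \<subseteq> I"
      using proj_eq_iff[OF k] by auto
    ultimately show "bij_betw (proj k) I I"
      using assms(2) by (simp add: bij_betw_def endo_inj_surj)
  qed (simp add: proj_def)
  moreover have "\<exists>!\<pi>. \<pi> \<in> proj ` K \<and> \<pi> i = i' \<and> \<pi> j = j'"
    if I: "i \<in> I" "j \<in> I" "i' \<in> I" "j' \<in> I" and ne: "i \<noteq> j" "i' \<noteq> j'" for i j i' j'
  proof -
    have rs: "r h \<noteq> s h'" if "h \<in> I" "h' \<in> I" for h h'
      using rD sD that by metis
    \<comment> \<open>By concurrency, a line inducing both required values must pass through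
      \<open>a\<close> and \<open>b\<close>, so their join is the only candidate.\<close>
    define a where "a = meet (r i) (s i')"
    define b where "b = meet (r j) (s j')"
    have a: "a \<in> r i" "a \<in> s i'" and b: "b \<in> r j" "b \<in> s j'"
      using meet rD sD rs I by (auto simp: a_def b_def)
    have axy: "a \<noteq> x" "a \<noteq> y" "b \<noteq> x" "b \<noteq> y"
      using a b rD sD I by metis+
    have ab: "a \<noteq> b"
      using a b axy rD ne I r_inj lines_eqI by metis
    have P: "a \<in> P" "b \<in> P"
      using a b rD I point_of_line by blast+
    define k where "k = join a b"
    have k: "k \<in> L" "a \<in> k" "b \<in> k"
      using join P ab by (auto simp: k_def)
    \<comment> \<open>If \<open>x\<close> were on \<open>k\<close>, then \<open>k\<close> would
      equal \<open>r i\<close>, through \<open>x\<close> and \<open>a\<close>, as well as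
      \<open>r j\<close>, through \<open>x\<close> and \<open>b\<close>. The argument for
      \<open>y\<close> is the same with \<open>s\<close>.\<close>
    have "x \<notin> k"
      using lines_eqI[of k "r i" x a] lines_eqI[of k "r j" x b] k a b axy rD I r_inj ne by metis
    moreover have "y \<notin> k"
      using lines_eqI[of k "s i'" y a] lines_eqI[of k "s j'" y b] k a b axy sD I s_inj ne by metis
    ultimately have K: "k \<in> K"
      using k by (simp add: K_def)
    show ?thesis
    proof (rule ex1I[of _ "proj k"])
      show "proj k \<in> proj ` K \<and> proj k i = i' \<and> proj k j = j'"
        using K I a b k proj_eq_iff meet_K_eqI by auto
      show "\<pi> = proj k" if \<pi>: "\<pi> \<in> proj ` K \<and> \<pi> i = i' \<and> \<pi> j = j'" for \<pi>
      proof -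
        obtain k' where k': "k' \<in> K" "\<pi> = proj k'"
          using \<pi> by blast
        then have "meet (r i) k' \<in> s i'" "meet (r j) k' \<in> s j'"
          using \<pi> I proj_eq_iff by auto
        then have "meet (r i) k' = a" "meet (r j) k' = b"
          using meet_K[OF k'(1)] I meet_eq rD sD rs unfolding a_def b_def by metis+
        then have "a \<in> k'" "b \<in> k'"
          using meet_K[OF k'(1)] I by auto
        then have "k' = k"
          using k' k ab lines_eqI by (auto simp: K_def)
        then show ?thesis
          using k' by simp
      qed
    qed
  qed
  ultimately show ?thesis
    unfolding sharply_transitive_on_def by (intro exI[of _ "proj ` K"]) auto
qed

section \<open>The product construction\<close>

text \<open>The condition on a pair \<open>(g, \<pi>)\<close> separates: the indices constrain only
  \<open>\<pi>\<close>, and the colours prescribe \<open>g\<close> at the two target indices, which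
  are distinct, so the array has exactly one such row.\<close>

lemma sharply_transitive_wreath:
  assumes "orthogonal_array {1..n} (carrier (integer_mod_group m)) A"
    and "\<And>\<pi>. \<pi> \<in> D \<Longrightarrow> \<pi> permutes {1..n}"
    and "sharply_transitive_on (\<lambda>\<pi>. map_prod \<pi> \<pi>) D {(i, j). i \<in> {1..n} \<and> j \<in> {1..n} \<and> i \<noteq> j}"
  shows "A \<times> D \<subseteq> carrier (cyclic_wreath m n)"
    and "sharply_transitive_on (wreath_act_pair m) (A \<times> D) (coloured_pairs m n)"
proof -
  let ?Z = "integer_mod_group m"
  interpret Z: group ?Z
    by simp
  have A: "g \<in> {1..n} \<rightarrow>\<^sub>E carrier ?Z" if "g \<in> A" for g
    using assms(1) that by (auto simp: orthogonal_array_def)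
  then show "A \<times> D \<subseteq> carrier (cyclic_wreath m n)"
    using assms(2) by (auto simp: cyclic_wreath_carrier)
  have "\<exists>!y. y \<in> A \<times> D \<and> wreath_act_pair m y ((c, i), (d, j)) = ((c', i'), (d', j'))"
    if col: "c \<in> carrier ?Z" "d \<in> carrier ?Z" "c' \<in> carrier ?Z" "d' \<in> carrier ?Z"
      and ind: "i \<in> {1..n}" "j \<in> {1..n}" "i' \<in> {1..n}" "j' \<in> {1..n}" "i \<noteq> j" "i' \<noteq> j'"
    for c d c' d' i j i' j'
  proof -
    \<comment> \<open>The colour shifts \<open>c' - c\<close> and \<open>d' - d\<close>. The action
      adds \<open>g (\<pi> i)\<close>, so they are the values of \<open>g\<close> at
      \<open>i'\<close> and \<open>j'\<close>, not at \<open>i\<close> and \<open>j\<close>.\<close>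
    define u where "u = inv\<^bsub>?Z\<^esub> c \<otimes>\<^bsub>?Z\<^esub> c'"
    define v where "v = inv\<^bsub>?Z\<^esub> d \<otimes>\<^bsub>?Z\<^esub> d'"
    have uv: "u \<in> carrier ?Z" "v \<in> carrier ?Z"
      using col by (simp_all only: u_def v_def Z.m_closed Z.inv_closed)
    have act: "wreath_act_pair m (g, \<pi>) ((c, i), (d, j)) = ((c', i'), (d', j')) \<longleftrightarrow>
        \<pi> i = i' \<and> \<pi> j = j' \<and> g i' = u \<and> g j' = v" if "g \<in> A" for g \<pi>
    proof -
      have "g i' \<in> carrier ?Z" "g j' \<in> carrier ?Z"
        using A[OF that] ind by blast+
      then have "c \<otimes>\<^bsub>?Z\<^esub> g i' = c' \<longleftrightarrow> g i' = u" "d \<otimes>\<^bsub>?Z\<^esub> g j' = d' \<longleftrightarrow> g j' = v"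
        unfolding u_def v_def using col Z.inv_solve_left by metis+
      then show ?thesis
        unfolding wreath_act_pair_def wreath_act_def by auto
    qed
    have "(i, j) \<in> {(i, j). i \<in> {1..n} \<and> j \<in> {1..n} \<and> i \<noteq> j}"
      "(i', j') \<in> {(i, j). i \<in> {1..n} \<and> j \<in> {1..n} \<and> i \<noteq> j}"
      using ind by auto
    then have "\<exists>!\<pi>. \<pi> \<in> D \<and> map_prod \<pi> \<pi> (i, j) = (i', j')"
      using assms(3) unfolding sharply_transitive_on_def by blast
    then have "\<exists>!\<pi>. \<pi> \<in> D \<and> \<pi> i = i' \<and> \<pi> j = j'"
      by simp
    moreover have "\<exists>!g. g \<in> A \<and> g i' = u \<and> g j' = v"
      using assms(1) ind uv unfolding orthogonal_array_def by blast
    ultimately obtain \<pi> g where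
      \<pi>: "\<pi> \<in> D" "\<pi> i = i'" "\<pi> j = j'" "\<And>\<pi>'. \<pi>' \<in> D \<and> \<pi>' i = i' \<and> \<pi>' j = j' \<Longrightarrow> \<pi>' = \<pi>" and
      g: "g \<in> A" "g i' = u" "g j' = v" "\<And>g'. g' \<in> A \<and> g' i' = u \<and> g' j' = v \<Longrightarrow> g' = g"
      by (elim ex1E) metis
    show ?thesis
    proof (rule ex1I[of _ "(g, \<pi>)"])
      show "(g, \<pi>) \<in> A \<times> D \<and> wreath_act_pair m (g, \<pi>) ((c, i), (d, j)) = ((c', i'), (d', j'))"
        using \<pi>(1-3) g(1-3) act by simp
      show "y = (g, \<pi>)"
        if "y \<in> A \<times> D \<and> wreath_act_pair m y ((c, i), (d, j)) = ((c', i'), (d', j'))" for y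
        using that \<pi>(4) g(4) act by (cases y) auto
    qed
  qed
  then show "sharply_transitive_on (wreath_act_pair m) (A \<times> D) (coloured_pairs m n)"
    unfolding sharply_transitive_on_def coloured_pairs_def coloured_points_def by auto
qed

theorem theorem8p3:
  fixes n :: nat
  assumes "n \<ge> 2"
    and "\<not> (\<exists>Y. Y \<subseteq> carrier (cyclic_wreath (n - 1) n) \<and>
                sharply_transitive_on (wreath_act_pair (n - 1)) Y (coloured_pairs (n - 1) n))"
  shows "\<not> (\<exists>(P :: 'p set) L. projective_plane_of_order (n - 1) P L) \<or>
         \<not> (\<exists>(P :: 'q set) L. projective_plane_of_order n P L)"
proof (rule ccontr)
  assume "\<not> ?thesis"
  then obtain P :: "'p set" and L and P' :: "'q set" and L' where
    planes: "projective_plane_of_order (n - 1) P L" "projective_plane_of_order n P' L'"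
    by blast
  \<comment> \<open>Here \<open>n \<ge> 2\<close> matters: for modulus 0 the group would be all the
    integers, not a set of \<open>n - 1\<close> symbols.\<close>
  have "carrier (integer_mod_group (n - 1)) = {0..<int (n - 1)}"
    using assms(1) by (simp add: carrier_integer_mod_group)
  then have "finite (carrier (integer_mod_group (n - 1)))"
    "card (carrier (integer_mod_group (n - 1))) = n - 1"
    by simp_all
  then obtain A where A: "orthogonal_array {1..n} (carrier (integer_mod_group (n - 1))) A"
    using orthogonal_array_of_plane[OF planes(1), of "{1..n}"] assms(1) by auto
  obtain D where D: "\<And>\<pi>. \<pi> \<in> D \<Longrightarrow> \<pi> permutes {1..n}"
    "sharply_transitive_on (\<lambda>\<pi>. map_prod \<pi> \<pi>) D {(i, j). i \<in> {1..n} \<and> j \<in> {1..n} \<and> i \<noteq> j}"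
    using sharply_2_transitive_of_plane[OF planes(2), of "{1..n}"] assms(1) by auto
  show False
    using assms(2) sharply_transitive_wreath[OF A D] by blast
qed

end
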